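(* $\mathsf{ERT}\equiv_{\mathrm W}\mathsf{LPO}^*$.
   Context: A Weihrauch problem is a relation $P\subseteq\mathbb N^{\mathbb N}\times\mathbb N$, viewed as a multifunction taking an instance $I\in\mathrm{domain}(P)$ to any solution $S$ with $(I,S)\in P$ (with numbers, pairs and finite sequences coded in the standard computable way where needed). $P\le_{\mathrm W}Q$ means that there are computable functionals $\Phi,\Psi$ such that for all $I\in\mathrm{domain}(P)$, $\Phi(I)\in\mathrm{domain}(Q)$, and for all $S$ with $(\Phi(I),S)\in Q$ we have $(I,\Psi(I,S))\in P$. $P\equiv_{\mathrm W}Q$ means $P\le_{\mathrm W}Q$ and $Q\le_{\mathrm W}P$. $P^*$ is the result of an arbitrary finite number of parallel applications of $P$: an instance is a number $n\in\mathbb N$ together with $n$ instances $I_1,\dots,I_n$ of $P$, and a solution is a (coded) tuple $(S_1,\dots,S_n)$ with each $S_i$ a solution of $I_i$. $\mathsf{LPO}$: an instance is any $f\in\mathbb N^{\mathbb N}$; the solution is $0$ if $\exists n\, f(n)=0$, and $1$ otherwise. $\mathsf{ERT}$: an instance is a number $k$ and a function $f:\mathbb N\to k$ (where $k=\{0,\dots,k-1\}$); a solution is any $b\in\mathbb N$ such that $\forall n\ge b\,\exists m\ge b\,(m\ne n\wedge f(m)=f(n))$. *)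

theory Defs
  imports Main "HOL-Library.Nat_Bijection"
begin

type_synonym baire = "nat \<Rightarrow> nat"

section \<open>Computable functionals\<close>

text \<open>
  Partial recursive functions with an oracle. A program denotes, for each oracle \<open>I\<close>, a partial
  function on argument lists; \<open>None\<close> stands for divergence (or a wrong number of arguments).
\<close>

datatype prog =
    Zero
  | Succ
  | Proj nat
  | Oracle
  | Comp prog "prog list"
  | PrimRec prog prog
  | Mu prog

primrec eval :: "baire \<Rightarrow> prog \<Rightarrow> nat list \<Rightarrow> nat option" where
  "eval I Zero = (\<lambda>xs. Some 0)"
| "eval I Succ = (\<lambda>xs. case xs of [x] \<Rightarrow> Some (Suc x) | _ \<Rightarrow> None)"
| "eval I (Proj i) = (\<lambda>xs. if i < length xs then Some (xs ! i) else None)"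
| "eval I Oracle = (\<lambda>xs. case xs of [x] \<Rightarrow> Some (I x) | _ \<Rightarrow> None)"
| "eval I (Comp f gs) =
    (\<lambda>xs. Option.bind (those (map (\<lambda>g. eval I g xs) gs)) (eval I f))"
| "eval I (PrimRec f g) =
    (\<lambda>xs. case xs of
        [] \<Rightarrow> None
      | n # ys \<Rightarrow>
          rec_nat (eval I f ys) (\<lambda>m r. Option.bind r (\<lambda>z. eval I g (m # z # ys))) n)"
| "eval I (Mu f) =
    (\<lambda>xs. if \<exists>n. eval I f (n # xs) = Some 0 \<and> (\<forall>m<n. \<exists>y>0. eval I f (m # xs) = Some y)
          then Some (LEAST n. eval I f (n # xs) = Some 0)
          else None)"

text \<open>
  As usual in computable analysis, a partial functional is computable if some program computes it
  on its domain; the program may also converge elsewhere.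
\<close>

definition computable_functional :: "(baire \<rightharpoonup> baire) \<Rightarrow> bool" where
  "computable_functional \<Phi> \<longleftrightarrow>
    (\<exists>e. \<forall>I J. \<Phi> I = Some J \<longrightarrow> (\<forall>n. eval I e [n] = Some (J n)))"

definition computable_functional_nat :: "(baire \<times> nat \<rightharpoonup> nat) \<Rightarrow> bool" where
  "computable_functional_nat \<Psi> \<longleftrightarrow>
    (\<exists>e. \<forall>I S T. \<Psi> (I, S) = Some T \<longrightarrow> eval I e [S] = Some T)"

section \<open>Weihrauch problems\<close>

type_synonym problem = "(baire \<times> nat) set"

definition weihrauch_le :: "problem \<Rightarrow> problem \<Rightarrow> bool" (infix "\<le>\<^sub>W" 50) where
  "P \<le>\<^sub>W Q \<longleftrightarrow>
    (\<exists>\<Phi> \<Psi>. computable_functional \<Phi> \<and> computable_functional_nat \<Psi> \<and>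
      (\<forall>I \<in> Domain P. \<exists>J. \<Phi> I = Some J \<and> J \<in> Domain Q \<and>
        (\<forall>S. (J, S) \<in> Q \<longrightarrow> (\<exists>T. \<Psi> (I, S) = Some T \<and> (I, T) \<in> P))))"

definition weihrauch_equiv :: "problem \<Rightarrow> problem \<Rightarrow> bool" (infix "\<equiv>\<^sub>W" 50) where
  "P \<equiv>\<^sub>W Q \<longleftrightarrow> P \<le>\<^sub>W Q \<and> Q \<le>\<^sub>W P"

text \<open>
  A finite sequence of points of Baire space is coded as a single point: the length comes first,
  followed by the entries \<open>(Is ! i) m\<close> at the positions coding \<open>(i, m)\<close>, padded with zeros.
\<close>

definition code_seq :: "baire list \<Rightarrow> baire" where
  "code_seq Is = case_nat (length Is)
    (\<lambda>p. case prod_decode p of (i, m) \<Rightarrow> if i < length Is then (Is ! i) m else 0)"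

definition star :: "problem \<Rightarrow> problem" where
  "star P = {(code_seq Is, list_encode Ss) |Is Ss. list_all2 (\<lambda>I S. (I, S) \<in> P) Is Ss}"

definition LPO :: problem where
  "LPO = {(f, if \<exists>n. f n = 0 then 0 else 1) |f. True}"

text \<open>The pair of \<open>k\<close> and \<open>f\<close> is coded as the sequence \<open>k, f 0, f 1, \<dots>\<close>.\<close>

definition ERT :: problem where
  "ERT = {(case_nat k f, b) |k f b.
    (\<forall>n. f n < k) \<and> (\<forall>n\<ge>b. \<exists>m\<ge>b. m \<noteq> n \<and> f m = f n)}"

end

theory Submission imports Defs begin

text \<open>
  A number \<open>b\<close> solves an instance of \<open>ERT\<close> iff no colour occurs exactly once at the positions
  \<open>\<ge> b\<close>.

  \<^emph>\<open>\<open>ERT\<close> reduces to \<open>LPO\<^sup>*\<close>.\<close> A solution can be found in the limit with boundedly many mind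
  changes. Fix a finite stage \<open>s\<close>, at which only the colours at positions \<open>< s\<close> are visible. Start
  with \<open>b = 0\<close>, and \<open>k\<close> times move \<open>b\<close> past all positions in \<open>[b, s)\<close> whose colour is seen only once
  there. A step that moves \<open>b\<close> at all removes a colour from \<open>[b, s)\<close>, so after \<open>k\<close> steps no such
  position is left (\<open>trims_no_single\<close>): the final \<open>b\<close> is right as far as stage \<open>s\<close> can tell. While the
  start of a step stays fixed, its outcome changes only when a colour is seen for the first or for
  the second time, that is, at most \<open>2 * k\<close> times. The numbers of these events for the \<open>k\<close> steps, each
  counted from the current start of the step, are therefore the digits of a numeral \<open>rank\<close> in base
  \<open>2 * k + 1\<close>, which never decreases with the stage and which determines the final \<open>b\<close>
  (\<open>rank_mono\<close>). It stays below \<open>(2 * k + 1) ^ k\<close>, and so its maximum can be read off from the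
  answers to the finitely many questions ``does the rank ever exceed \<open>i\<close>?'', each an instance of
  \<open>LPO\<close>. The value of \<open>b\<close> at any stage of maximal rank is never revised and hence is a solution
  (\<open>trims_solution\<close>).

  \<^emph>\<open>\<open>LPO\<^sup>*\<close> reduces to \<open>ERT\<close>.\<close> Given \<open>n\<close> instances of \<open>LPO\<close>, colour each position by a neutral
  colour, except that the \<open>i\<close>-th instance puts its own colour \<open>i\<close> at the position coding \<open>(i, m)\<close> if
  \<open>m\<close> is its first zero. This colour then occurs once, or never if there is no zero. Any solution
  \<open>b\<close> lies beyond all those single occurrences, and so every instance that has a zero at all has one
  below \<open>b\<close> (\<open>zero_before_solution\<close>).
\<close>

section \<open>Uniformly computable functions\<close>

text \<open>
  One program serves all oracles and all argument lists of length \<open>n\<close>. The closure rules below are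
  written so that the computability of an explicit function follows by introduction: arguments are
  the terms \<open>xs ! i\<close>, and a construct that binds a variable, such as a recursion or a bounded
  quantifier, puts that variable in front of the list, so that the old arguments become
  \<open>drop d ys\<close>.
\<close>

definition computable :: "nat \<Rightarrow> (baire \<Rightarrow> nat list \<Rightarrow> nat) \<Rightarrow> bool" where
  "computable n F \<longleftrightarrow> (\<exists>e. \<forall>I xs. length xs = n \<longrightarrow> eval I e xs = Some (F I xs))"

definition decidable :: "nat \<Rightarrow> (baire \<Rightarrow> nat list \<Rightarrow> bool) \<Rightarrow> bool" where
  "decidable n P \<longleftrightarrow> computable n (\<lambda>I xs. of_bool (P I xs))"

lemma computableI:
  assumes "\<And>I xs. length xs = n \<Longrightarrow> eval I e xs = Some (F I xs)"
  shows "computable n F"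
  using assms unfolding computable_def by blast

lemma computable_cong:
  assumes "computable n F" "\<And>I xs. length xs = n \<Longrightarrow> F I xs = G I xs"
  shows "computable n G"
  using assms unfolding computable_def by auto

lemma computable_var: "i < n \<Longrightarrow> computable n (\<lambda>I xs. xs ! i)"
  by (rule computableI[where e = "Proj i"]) simp

lemma computable_var_drop: "d + i < n \<Longrightarrow> computable n (\<lambda>I xs. drop d xs ! i)"
  by (rule computableI[where e = "Proj (d + i)"]) simp

lemma computable_var_drop_drop:
  "computable n (\<lambda>I xs. drop (d + d') xs ! i) \<Longrightarrow> computable n (\<lambda>I xs. drop d (drop d' xs) ! i)"
  by simp

lemma those_map_eval:
  fixes xs :: "nat list"
  assumes "list_all2 (\<lambda>e G. eval I e xs = Some (G I xs)) es Gs"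
  shows "those (map (\<lambda>e. eval I e xs) es) = Some (map (\<lambda>G. G I xs) Gs)"
  using assms by (induction rule: list_all2_induct) auto

lemma computable_comp:
  assumes "computable (length Gs) F" "\<And>G. G \<in> set Gs \<Longrightarrow> computable n G"
  shows "computable n (\<lambda>I xs. F I (map (\<lambda>G. G I xs) Gs))"
proof -
  obtain f where f: "\<And>I xs. length xs = length Gs \<Longrightarrow> eval I f xs = Some (F I xs)"
    using assms(1) unfolding computable_def by blast
  obtain c where c: "\<And>G I xs. G \<in> set Gs \<Longrightarrow> length xs = n \<Longrightarrow> eval I (c G) xs = Some (G I xs)"
    using assms(2) unfolding computable_def by metis
  show ?thesis
  proof (rule computableI[where e = "Comp f (map c Gs)"])
    fix I and xs :: "nat list" assume "length xs = n"
    then have "list_all2 (\<lambda>e G. eval I e xs = Some (G I xs)) (map c Gs) Gs"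
      using c by (simp add: list_all2_map1 list.rel_refl_strong)
    from those_map_eval[OF this]
    show "eval I (Comp f (map c Gs)) xs = Some (F I (map (\<lambda>G. G I xs) Gs))"
      by (simp add: f)
  qed
qed

lemma computable_comp1:
  assumes "computable 1 (\<lambda>I ys. h I (ys ! 0))" "computable n A"
  shows "computable n (\<lambda>I xs. h I (A I xs))"
  using computable_comp[of "[A]" "\<lambda>I ys. h I (ys ! 0)" n] assms by simp

lemma computable_comp2:
  assumes "computable 2 (\<lambda>I ys. h I (ys ! 0) (ys ! 1))" "computable n A" "computable n B"
  shows "computable n (\<lambda>I xs. h I (A I xs) (B I xs))"
  using computable_comp[of "[A, B]" "\<lambda>I ys. h I (ys ! 0) (ys ! 1)" n] assms
  by (auto simp: numeral_2_eq_2)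

lemma decidable_comp3:
  assumes "decidable 3 (\<lambda>I ys. h I (ys ! 0) (ys ! 1) (ys ! 2))"
    and "computable n A" "computable n B" "computable n C"
  shows "decidable n (\<lambda>I xs. h I (A I xs) (B I xs) (C I xs))"
  using computable_comp[of "[A, B, C]" "\<lambda>I ys. of_bool (h I (ys ! 0) (ys ! 1) (ys ! 2))" n] assms
  unfolding decidable_def by (auto simp: numeral_3_eq_3 numeral_2_eq_2)

lemma decidable_comp2:
  assumes "decidable 2 (\<lambda>I ys. h I (ys ! 0) (ys ! 1))"
    and "computable n A" "computable n B"
  shows "decidable n (\<lambda>I xs. h I (A I xs) (B I xs))"
  using computable_comp2[of "\<lambda>I x y. of_bool (h I x y)"] assms unfolding decidable_def by blast

lemma computable_oracle: "computable n A \<Longrightarrow> computable n (\<lambda>I xs. I (A I xs))"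
  by (rule computable_comp1[where h = "\<lambda>I. I"], rule computableI[where e = Oracle])
    (auto simp: length_Suc_conv)

lemma computable_Suc: "computable n A \<Longrightarrow> computable n (\<lambda>I xs. Suc (A I xs))"
  by (rule computable_comp1[where h = "\<lambda>I. Suc"], rule computableI[where e = Succ])
    (auto simp: length_Suc_conv)

lemma computable_const: "computable n (\<lambda>I xs. c)"
proof (induction c)
  case 0
  show ?case by (rule computableI[where e = Zero]) simp
qed (rule computable_Suc)

lemma those_projections: "those (map (\<lambda>g. eval I g xs) (map Proj [0..<length xs])) = Some xs"
proof -
  have "map (\<lambda>g. eval I g xs) (map Proj [0..<length xs]) = map Some (map ((!) xs) [0..<length xs])"
    by simp
  moreover have "those (map Some ys) = Some ys" for ys :: "nat list"
    by (induction ys) auto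
  ultimately show ?thesis
    by (simp only: map_nth)
qed

lemma computable_rec_nat:
  assumes "computable n A" "computable n Z"
    and "computable (Suc (Suc n)) (\<lambda>I ys. H I (drop 2 ys) (ys ! 0) (ys ! 1))"
  shows "computable n (\<lambda>I xs. rec_nat (Z I xs) (\<lambda>m z. H I xs m z) (A I xs))"
proof -
  obtain a where a: "\<And>I xs. length xs = n \<Longrightarrow> eval I a xs = Some (A I xs)"
    using assms(1) unfolding computable_def by blast
  obtain z where z: "\<And>I xs. length xs = n \<Longrightarrow> eval I z xs = Some (Z I xs)"
    using assms(2) unfolding computable_def by blast
  obtain h where h: "\<And>I ys. length ys = Suc (Suc n) \<Longrightarrow>
      eval I h ys = Some (H I (drop 2 ys) (ys ! 0) (ys ! 1))"
    using assms(3) unfolding computable_def by blast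
  show ?thesis
  proof (rule computableI[where e = "Comp (PrimRec z h) (a # map Proj [0..<n])"])
    fix I and xs :: "nat list" assume n: "length xs = n"
    have "rec_nat (eval I z xs) (\<lambda>m r. Option.bind r (\<lambda>w. eval I h (m # w # xs))) k
        = Some (rec_nat (Z I xs) (H I xs) k)" for k
      by (induction k) (simp_all add: z h n)
    moreover have "those (map (\<lambda>g. eval I g xs) (map Proj [0..<n])) = Some xs"
      using those_projections[of I xs] by (simp only: n)
    ultimately show "eval I (Comp (PrimRec z h) (a # map Proj [0..<n])) xs
        = Some (rec_nat (Z I xs) (\<lambda>m z. H I xs m z) (A I xs))"
      by (simp add: a n)
  qed
qed

lemmas computable_basic = computable_var computable_var_drop computable_var_drop_drop
  computable_oracle computable_Suc computable_const computable_rec_nat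

lemma computable_add:
  assumes "computable n A" "computable n B"
  shows "computable n (\<lambda>I xs. A I xs + B I xs)"
proof (rule computable_comp2[OF _ assms])
  have "rec_nat a (\<lambda>m z. Suc z) b = a + b" for a b :: nat
    by (induction b) auto
  moreover have "computable 2 (\<lambda>I ys. rec_nat (ys ! 0) (\<lambda>m z. Suc z) (ys ! 1))"
    by (intro computable_basic) simp_all
  ultimately show "computable 2 (\<lambda>I ys. ys ! 0 + ys ! 1)" by simp
qed

lemma computable_diff:
  assumes "computable n A" "computable n B"
  shows "computable n (\<lambda>I xs. A I xs - B I xs)"
proof (rule computable_comp2[OF _ assms])
  have pred: "computable m (\<lambda>I xs. C I xs - 1)" if "computable m C" for m C
  proof (rule computable_comp1[OF _ that])
    have "rec_nat 0 (\<lambda>m z. m) a = a - 1" for a :: nat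
      by (cases a) auto
    moreover have "computable 1 (\<lambda>I ys. rec_nat 0 (\<lambda>m z. m) (ys ! 0))"
      by (intro computable_basic) simp_all
    ultimately show "computable 1 (\<lambda>I ys. ys ! 0 - 1)" by simp
  qed
  have "rec_nat a (\<lambda>m z. z - 1) b = a - b" for a b :: nat
    by (induction b) auto
  moreover have "computable 2 (\<lambda>I ys. rec_nat (ys ! 0) (\<lambda>m z. z - 1) (ys ! 1))"
    by (intro computable_basic pred) simp_all
  ultimately show "computable 2 (\<lambda>I ys. ys ! 0 - ys ! 1)" by simp
qed

lemma map_drop: "length ys = d + n \<Longrightarrow> map (\<lambda>i. ys ! (d + i)) [0..<n] = drop d ys"
  by (intro nth_equalityI) auto

text \<open>
  This lemma and the next one rename variables: they bring a function of the old arguments, or of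
  the old arguments and one bound variable, under further binders.
\<close>

lemma computable_weaken:
  assumes "computable n B"
  shows "computable (d + n) (\<lambda>I ys. B I (drop d ys))"
proof -
  let ?Gs = "map (\<lambda>i I ys. ys ! (d + i)) [0..<n] :: (baire \<Rightarrow> nat list \<Rightarrow> nat) list"
  have "computable (d + n) (\<lambda>I ys. B I (map (\<lambda>G. G I ys) ?Gs))"
    by (rule computable_comp) (use assms in \<open>auto intro!: computable_var\<close>)
  then show ?thesis
    by (rule computable_cong) (simp add: comp_def map_drop)
qed

lemma computable_substitute:
  assumes "computable (Suc n) (\<lambda>I ys. H I (drop 1 ys) (ys ! 0))" "computable (d + n) C"
  shows "computable (d + n) (\<lambda>I ys. H I (drop d ys) (C I ys))"
proof -
  let ?Gs = "C # map (\<lambda>i I ys. ys ! (d + i)) [0..<n]"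
  have "computable (d + n) (\<lambda>I ys. (\<lambda>zs. H I (drop 1 zs) (zs ! 0)) (map (\<lambda>G. G I ys) ?Gs))"
    by (rule computable_comp) (use assms in \<open>auto intro!: computable_var\<close>)
  then show ?thesis
    by (rule computable_cong) (simp add: comp_def map_drop)
qed

lemma computable_sum:
  assumes "computable n A" "computable (Suc n) (\<lambda>I ys. F I (drop 1 ys) (ys ! 0))"
  shows "computable n (\<lambda>I xs. \<Sum>m<A I xs. F I xs m)"
proof -
  have "computable (Suc (Suc n)) (\<lambda>I ys. F I (drop 2 ys) (ys ! 0))"
    using computable_substitute[OF assms(2), of 2 "\<lambda>I ys. ys ! 0"] by (simp add: computable_var)
  then have "computable n (\<lambda>I xs. rec_nat 0 (\<lambda>m z. z + F I xs m) (A I xs))"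
    by (intro computable_basic assms computable_add) simp_all
  moreover have "rec_nat 0 (\<lambda>m z. z + g m) k = (\<Sum>m<k. g m)" for g :: "nat \<Rightarrow> nat" and k
    by (induction k) auto
  ultimately show ?thesis by (simp only:)
qed

lemma computable_mult:
  assumes "computable n A" "computable n B"
  shows "computable n (\<lambda>I xs. A I xs * B I xs)"
proof (rule computable_comp2[OF _ assms])
  have "computable 2 (\<lambda>I ys. \<Sum>m<ys ! 0. ys ! 1)"
    by (intro computable_basic computable_sum) simp_all
  then show "computable 2 (\<lambda>I ys. ys ! 0 * ys ! 1)" by simp
qed

lemma computable_power:
  assumes "computable n A" "computable n B"
  shows "computable n (\<lambda>I xs. A I xs ^ B I xs)"
proof (rule computable_comp2[OF _ assms])
  have "rec_nat 1 (\<lambda>m z. a * z) b = a ^ b" for a b :: nat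
    by (induction b) auto
  moreover have "computable 2 (\<lambda>I ys. rec_nat 1 (\<lambda>m z. ys ! 0 * z) (ys ! 1))"
    by (intro computable_basic computable_mult) simp_all
  ultimately show "computable 2 (\<lambda>I ys. ys ! 0 ^ ys ! 1)" by simp
qed

lemma decidable_le:
  assumes "computable n A" "computable n B"
  shows "decidable n (\<lambda>I xs. A I xs \<le> B I xs)"
proof -
  have "of_bool (a \<le> b) = 1 - (a - b)" for a b :: nat by auto
  then show ?thesis unfolding decidable_def
    by (auto simp del: of_bool_eq intro!: computable_diff computable_const assms)
qed

lemma decidable_not:
  assumes "decidable n P"
  shows "decidable n (\<lambda>I xs. \<not> P I xs)"
proof -
  have "of_bool (\<not> p) = 1 - (of_bool p :: nat)" for p by simp
  with assms show ?thesis
    unfolding decidable_def by (simp only:) (intro computable_diff computable_const)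
qed

lemma decidable_conj:
  assumes "decidable n P" "decidable n Q"
  shows "decidable n (\<lambda>I xs. P I xs \<and> Q I xs)"
  using assms unfolding decidable_def of_bool_conj by (rule computable_mult)

lemma decidable_imp:
  assumes "decidable n P" "decidable n Q"
  shows "decidable n (\<lambda>I xs. P I xs \<longrightarrow> Q I xs)"
  using decidable_not[OF decidable_conj[OF assms(1) decidable_not[OF assms(2)]]] by simp

lemma decidable_less:
  assumes "computable n A" "computable n B"
  shows "decidable n (\<lambda>I xs. A I xs < B I xs)"
  using decidable_not[OF decidable_le[OF assms(2,1)]] by (simp add: not_le)

lemma decidable_eq:
  assumes "computable n A" "computable n B"
  shows "decidable n (\<lambda>I xs. A I xs = B I xs)"
  using decidable_conj[OF decidable_le[OF assms] decidable_le[OF assms(2,1)]]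
  by (simp add: order_eq_iff)

lemma decidable_all_less:
  assumes "computable n A" "decidable (Suc n) (\<lambda>I ys. P I (drop 1 ys) (ys ! 0))"
  shows "decidable n (\<lambda>I xs. \<forall>m<A I xs. P I xs m)"
proof -
  have "decidable n (\<lambda>I xs. (\<Sum>m<A I xs. of_bool (\<not> P I xs m)) \<le> (0 :: nat))"
    by (intro decidable_le computable_sum computable_const assms(1)
        decidable_not[OF assms(2), unfolded decidable_def])
  moreover have "(\<Sum>m<k. of_bool (\<not> Q m)) \<le> (0 :: nat) \<longleftrightarrow> (\<forall>m<k. Q m)" for Q and k :: nat
    by (auto simp: lessThan_iff)
  ultimately show ?thesis by simp
qed

lemma decidable_ex_less:
  assumes "computable n A" "decidable (Suc n) (\<lambda>I ys. P I (drop 1 ys) (ys ! 0))"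
  shows "decidable n (\<lambda>I xs. \<exists>m<A I xs. P I xs m)"
  using decidable_not[OF decidable_all_less[OF assms(1) decidable_not[OF assms(2)]]] by simp

lemma computable_if:
  assumes "decidable n P" "computable n A" "computable n B"
  shows "computable n (\<lambda>I xs. if P I xs then A I xs else B I xs)"
proof -
  have "computable n (\<lambda>I xs. of_bool (P I xs) * A I xs + of_bool (\<not> P I xs) * B I xs)"
    using decidable_not[OF assms(1)] assms unfolding decidable_def
    by (intro computable_add computable_mult)
  then show ?thesis
    by (rule computable_cong) auto
qed

lemmas computable_intros = computable_basic computable_add computable_diff computable_sum
  computable_mult computable_power computable_if decidable_le decidable_not decidable_conj
  decidable_imp decidable_less decidable_eq decidable_all_less decidable_ex_less

lemma computable_prod_encode:
  assumes "computable n A" "computable n B"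
  shows "computable n (\<lambda>I xs. prod_encode (A I xs, B I xs))"
proof (rule computable_comp2[OF _ assms])
  have "triangle k = (\<Sum>i<Suc k. i)" for k
    by (induction k) auto
  then show "computable 2 (\<lambda>I ys. prod_encode (ys ! 0, ys ! 1))"
    unfolding prod_encode_def by (simp del: sum.lessThan_Suc) (intro computable_intros; simp)
qed

text \<open>
  Both components of a pair are at most its code, so they can be found by running through all small
  pairs; since exactly one pair has the code \<open>p\<close>, a sum does the work of a bounded search.
\<close>

lemma prod_decode_as_sum:
  "fst (prod_decode p) = (\<Sum>i<Suc p. \<Sum>m<Suc p. if prod_encode (i, m) = p then i else 0)"
  "snd (prod_decode p) = (\<Sum>i<Suc p. \<Sum>m<Suc p. if prod_encode (i, m) = p then m else 0)"
proof -
  obtain i m where im: "prod_decode p = (i, m)" by fastforce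
  then have p: "p = prod_encode (i, m)" by (metis prod_decode_inverse)
  have le: "i < Suc p" "m < Suc p"
    using le_prod_encode_1 le_prod_encode_2 by (auto simp: p less_Suc_eq_le)
  have "(\<Sum>i'<Suc p. \<Sum>m'<Suc p. if prod_encode (i', m') = p then g i' m' else 0) = g i m"
    for g :: "nat \<Rightarrow> nat \<Rightarrow> nat"
  proof -
    have "(\<Sum>i'<Suc p. \<Sum>m'<Suc p. if prod_encode (i', m') = p then g i' m' else 0)
        = (\<Sum>i'<Suc p. \<Sum>m'<Suc p. if i' = i then if m' = m then g i' m' else 0 else 0)"
      by (intro sum.cong) (auto simp: p prod_encode_eq)
    also have "\<dots> = (\<Sum>i'<Suc p. if i' = i then \<Sum>m'<Suc p. if m' = m then g i' m' else 0 else 0)"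
      by (intro sum.cong) auto
    also have "\<dots> = g i m"
      using le by (simp add: sum.delta del: sum.lessThan_Suc)
    finally show ?thesis .
  qed
  from this[of "\<lambda>i m. i"] this[of "\<lambda>i m. m"]
  show "fst (prod_decode p) = (\<Sum>i<Suc p. \<Sum>m<Suc p. if prod_encode (i, m) = p then i else 0)"
    and "snd (prod_decode p) = (\<Sum>i<Suc p. \<Sum>m<Suc p. if prod_encode (i, m) = p then m else 0)"
    by (simp_all only: im fst_conv snd_conv)
qed

lemma computable_fst_prod_decode:
  assumes "computable n A"
  shows "computable n (\<lambda>I xs. fst (prod_decode (A I xs)))"
  unfolding prod_decode_as_sum
  by (rule computable_comp1[OF _ assms]) (intro computable_intros computable_prod_encode; simp)

lemma computable_snd_prod_decode:
  assumes "computable n A"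
  shows "computable n (\<lambda>I xs. snd (prod_decode (A I xs)))"
  unfolding prod_decode_as_sum
  by (rule computable_comp1[OF _ assms]) (intro computable_intros computable_prod_encode; simp)

text \<open>
  Lists are coded from the back: the head is the last element to be added, whereas a primitive
  recursion counts upwards. Hence the index \<open>N - Suc j\<close> at step \<open>j\<close>.
\<close>

lemma list_encode_map_upt:
  "list_encode (map h [0..<N]) = rec_nat 0 (\<lambda>j z. Suc (prod_encode (h (N - Suc j), z))) N"
proof -
  have "rec_nat 0 (\<lambda>j z. Suc (prod_encode (h (N - Suc j), z))) j = list_encode (map h [N - j..<N])"
    if "j \<le> N" for j
    using that
  proof (induction j)
    case (Suc j)
    then have "[N - Suc j..<N] = (N - Suc j) # [N - j..<N]"
      by (metis Suc_diff_Suc Suc_le_lessD diff_less upt_conv_Cons zero_less_Suc less_le_trans)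
    with Suc show ?case by simp
  qed simp
  from this[of N] show ?thesis by simp
qed

lemma computable_list_encode_map_upt:
  assumes "computable n A" "computable (Suc n) (\<lambda>I ys. H I (drop 1 ys) (ys ! 0))"
  shows "computable n (\<lambda>I xs. list_encode (map (\<lambda>i. H I xs i) [0..<A I xs]))"
proof -
  have "computable (2 + n) (\<lambda>I ys. A I (drop 2 ys) - Suc (ys ! 0))"
    by (intro computable_diff computable_weaken assms(1) computable_intros) simp
  from computable_substitute[OF assms(2) this]
  show ?thesis
    unfolding list_encode_map_upt
    by (intro computable_rec_nat computable_intros computable_prod_encode assms(1)) simp_all
qed

section \<open>Trimming away the colours that occur only once\<close>

text \<open>
  Throughout, \<open>a\<close> is the start of a segment and \<open>s\<close> is its end, the current stage.
\<close>

definition single :: "baire \<Rightarrow> nat \<Rightarrow> nat \<Rightarrow> nat \<Rightarrow> bool" where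
  "single f a s n \<longleftrightarrow> a \<le> n \<and> n < s \<and> (\<forall>m<s. a \<le> m \<and> f m = f n \<longrightarrow> m = n)"

text \<open>
  The purpose is to get past all single positions; how far does not matter, as long as the outcome
  is \<open>a\<close> if there are none and depends on \<open>s\<close> only through their set. A sum achieves this and is
  visibly primitive recursive. The outcome may exceed \<open>s\<close>; the remaining segment is then empty.
\<close>

definition trim :: "baire \<Rightarrow> nat \<Rightarrow> nat \<Rightarrow> nat" where
  "trim f s a = a + (\<Sum>n<s. if single f a s n then Suc n else 0)"

text \<open>
  The position \<open>n\<close> carries the first or the second occurrence of its colour from \<open>a\<close> on. Only such
  positions can create or destroy a single position.
\<close>

definition fresh :: "baire \<Rightarrow> nat \<Rightarrow> nat \<Rightarrow> bool" where
  "fresh f a n \<longleftrightarrow> a \<le> n \<and> (\<forall>m<n. \<forall>l<m. a \<le> l \<and> f l = f n \<longrightarrow> f m \<noteq> f n)"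

definition fresh_count :: "baire \<Rightarrow> nat \<Rightarrow> nat \<Rightarrow> nat" where
  "fresh_count f a s = (\<Sum>n<s. if fresh f a n then 1 else 0)"

primrec trims :: "baire \<Rightarrow> nat \<Rightarrow> nat \<Rightarrow> nat" where
  "trims f s 0 = 0"
| "trims f s (Suc j) = trim f s (trims f s j)"

text \<open>
  The event counts of the first \<open>j\<close> trimming steps, read as the digits of a numeral in base
  \<open>2 * k + 1\<close> with the first step most significant, evaluated by Horner's scheme.
\<close>

primrec rank :: "nat \<Rightarrow> baire \<Rightarrow> nat \<Rightarrow> nat \<Rightarrow> nat" where
  "rank k f s 0 = 0"
| "rank k f s (Suc j) = Suc (2 * k) * rank k f s j + fresh_count f (trims f s j) s"

lemma fresh_count_card: "fresh_count f a s = card {n. n < s \<and> fresh f a n}"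
proof -
  have "{n. n < s \<and> fresh f a n} = {n \<in> {..<s}. fresh f a n}" by auto
  then show ?thesis
    unfolding fresh_count_def by (simp only: card_eq_sum) (rule sum.inter_filter[symmetric], simp)
qed

text \<open>
  A fresh position is determined by its colour and by whether the colour occurred before.
\<close>

lemma fresh_count_le:
  assumes "\<forall>n. f n < k"
  shows "fresh_count f a s \<le> 2 * k"
proof -
  let ?old = "\<lambda>n. \<exists>m<n. a \<le> m \<and> f m = f n"
  \<comment> \<open>Two old fresh positions of one colour would make the later one a third occurrence.\<close>
  have "inj_on (\<lambda>n. (f n, ?old n)) {n. n < s \<and> fresh f a n}"
  proof (rule linorder_inj_onI')
    fix i j assume "i \<in> {n. n < s \<and> fresh f a n}" "j \<in> {n. n < s \<and> fresh f a n}" "i < j"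
    then have ij: "fresh f a i" "fresh f a j" "i < j" "a \<le> i"
      by (auto simp: fresh_def)
    show "(f i, ?old i) \<noteq> (f j, ?old j)"
    proof
      assume "(f i, ?old i) = (f j, ?old j)"
      then have eq: "f i = f j" and "?old i = ?old j" by auto
      moreover have "?old j" using ij eq by auto
      ultimately obtain l where "l < i" "a \<le> l" "f l = f i" by auto
      with ij eq show False unfolding fresh_def by metis
    qed
  qed
  moreover have "(\<lambda>n. (f n, ?old n)) ` {n. n < s \<and> fresh f a n} \<subseteq> {..<k} \<times> UNIV"
    using assms by auto
  ultimately have "card {n. n < s \<and> fresh f a n} \<le> card ({..<k} \<times> (UNIV :: bool set))"
    by (rule card_inj_on_le) simp
  then show ?thesis
    by (simp add: fresh_count_card)
qed

lemma fresh_count_mono: "s \<le> t \<Longrightarrow> fresh_count f a s \<le> fresh_count f a t"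
  unfolding fresh_count_card by (rule card_mono) auto

text \<open>
  Without fresh positions in \<open>[s, t)\<close>, no colour occurs there that occurred at most once before.
\<close>

lemma single_stable:
  assumes "s \<le> t" "fresh_count f a s = fresh_count f a t"
  shows "single f a s = single f a t"
proof -
  have eq: "{n. n < s \<and> fresh f a n} = {n. n < t \<and> fresh f a n}"
    using assms by (intro card_subset_eq) (auto simp: fresh_count_card)
  have old: "\<not> fresh f a n" if "s \<le> n" "n < t" for n
  proof
    assume "fresh f a n"
    with that have "n \<in> {n. n < t \<and> fresh f a n}" by simp
    then have "n \<in> {n. n < s \<and> fresh f a n}" by (simp only: eq)
    with that show False by simp
  qed
  show ?thesis
  proof (rule ext, rule iffI)
    fix n assume n: "single f a s n"
    \<comment> \<open>A later occurrence would not be fresh, hence preceded by two others, both equal to \<open>n\<close>.\<close>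
    have "m = n" if "m < t" "a \<le> m" "f m = f n" for m
      using that
    proof (induction m rule: less_induct)
      case (less m)
      show ?case
      proof (rule ccontr)
        assume "m \<noteq> n"
        with n less.prems have "s \<le> m" unfolding single_def by (meson not_le)
        with old less.prems have "\<not> fresh f a m" by blast
        then obtain i l where "l < i" "i < m" "a \<le> l" "f l = f m" "f i = f m"
          using less.prems unfolding fresh_def by blast
        with less.IH[of i] less.IH[of l] less.prems show False by auto
      qed
    qed
    with n assms(1) show "single f a t n" by (auto simp: single_def)
  next
    fix n assume n: "single f a t n"
    have "fresh f a n"
      unfolding fresh_def
    proof (intro conjI allI impI)
      show "a \<le> n" using n by (simp add: single_def)
    next
      fix m l assume "m < n" "l < m" "a \<le> l \<and> f l = f n"
      with n have "l = n" by (auto simp: single_def)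
      with \<open>l < m\<close> \<open>m < n\<close> show "f m \<noteq> f n" by simp
    qed
    with old n have "n < s" unfolding single_def by (meson not_le)
    with n assms(1) show "single f a s n" by (auto simp: single_def)
  qed
qed

lemma trim_stable:
  assumes "s \<le> t" "fresh_count f a s = fresh_count f a t"
  shows "trim f s a = trim f t a"
proof -
  have "trim f u a = a + (\<Sum>n | single f a u n. Suc n)" for u
  proof -
    have "{n. single f a u n} = {n \<in> {..<u}. single f a u n}"
      by (auto simp: single_def)
    then show ?thesis by (simp only: trim_def) (subst sum.inter_filter, simp_all)
  qed
  then show ?thesis
    by (simp only: single_stable[OF assms])
qed

text \<open>
  Each digit is at most \<open>2 * k\<close> by \<open>fresh_count_le\<close>, so \<open>j\<close> digits stay below \<open>(2 * k + 1) ^ j\<close>.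
\<close>

lemma rank_less:
  assumes "\<forall>n. f n < k"
  shows "rank k f s j < Suc (2 * k) ^ j"
proof (induction j)
  case (Suc j)
  have "rank k f s (Suc j) < Suc (2 * k) * rank k f s j + Suc (2 * k)"
    using fresh_count_le[OF assms] by (simp add: less_Suc_eq_le)
  also have "\<dots> = Suc (2 * k) * Suc (rank k f s j)" by simp
  also have "\<dots> \<le> Suc (2 * k) * Suc (2 * k) ^ j"
    using Suc by (intro mult_le_mono2) simp
  finally show ?case by simp
qed simp

text \<open>
  The comparison is lexicographic. If the first \<open>j\<close> digits agree between the stages, then so do the
  starts of the next step; hence its event count is monotone, and if that agrees as well, the step
  has the same outcome at both stages. If the first \<open>j\<close> digits have increased, the next digit is too
  small to matter.
\<close>

lemma rank_mono:
  assumes "\<forall>n. f n < k" "s \<le> t"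
  shows "rank k f s j < rank k f t j \<or> rank k f s j = rank k f t j \<and> trims f s j = trims f t j"
proof (induction j)
  case (Suc j)
  then show ?case
  proof
    assume less: "rank k f s j < rank k f t j"
    have "rank k f s (Suc j) < Suc (2 * k) * rank k f s j + Suc (2 * k)"
      using fresh_count_le[OF assms(1)] by (simp add: less_Suc_eq_le)
    also have "\<dots> = Suc (2 * k) * Suc (rank k f s j)" by simp
    also have "\<dots> \<le> Suc (2 * k) * rank k f t j"
      using less by (intro mult_le_mono2) simp
    also have "\<dots> \<le> rank k f t (Suc j)" by simp
    finally show ?thesis by simp
  next
    assume eq: "rank k f s j = rank k f t j \<and> trims f s j = trims f t j"
    let ?a = "trims f t j"
    from fresh_count_mono[OF assms(2), of f ?a]
    have "fresh_count f ?a s < fresh_count f ?a t \<or> fresh_count f ?a s = fresh_count f ?a t"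
      by auto
    with eq trim_stable[OF assms(2), of f ?a] show ?thesis by auto
  qed
qed simp

lemma trim_ge: "a \<le> trim f s a"
  by (simp add: trim_def)

lemma trim_greater:
  assumes "single f a s n"
  shows "n < trim f s a"
proof -
  have "Suc n = (if single f a s n then Suc n else 0)" using assms by simp
  also have "\<dots> \<le> (\<Sum>n<s. if single f a s n then Suc n else 0)"
    using assms by (intro member_le_sum) (auto simp: single_def)
  finally show ?thesis by (simp add: trim_def)
qed

lemma trim_eq: "(\<And>n. \<not> single f a s n) \<Longrightarrow> trim f s a = a"
  by (simp add: trim_def)

text \<open>
  A step that finds a single position drops its colour from the remaining segment, because it moves
  past the only occurrence. So each step either has nothing to do or uses up one of the \<open>k\<close> colours.
\<close>

lemma trims_colours:
  assumes "\<forall>n. f n < k"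
  shows "(\<forall>n. \<not> single f (trims f s j) s n) \<or> card (f ` {trims f s j..<s}) + j \<le> k"
proof (induction j)
  case 0
  have "f ` {trims f s 0..<s} \<subseteq> {..<k}" using assms by auto
  from card_mono[OF _ this] show ?case by simp
next
  case (Suc j)
  let ?a = "trims f s j"
  show ?case
  proof (cases "\<exists>n. single f ?a s n")
    case False
    then show ?thesis by (simp add: trim_eq)
  next
    case True
    then obtain n where n: "single f ?a s n" by blast
    have "f ` {trim f s ?a..<s} \<subset> f ` {?a..<s}"
    proof (rule psubsetI)
      show "f ` {trim f s ?a..<s} \<subseteq> f ` {?a..<s}"
        using trim_ge[of ?a f s] by (intro image_mono) auto
      have "f n \<in> f ` {?a..<s}" using n by (auto simp: single_def)
      moreover have "f n \<notin> f ` {trim f s ?a..<s}"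
        using n trim_greater[OF n] trim_ge[of ?a f s] by (force simp: single_def)
      ultimately show "f ` {trim f s ?a..<s} \<noteq> f ` {?a..<s}" by blast
    qed
    then have "card (f ` {trim f s ?a..<s}) < card (f ` {?a..<s})"
      by (intro psubset_card_mono) auto
    with Suc True show ?thesis by auto
  qed
qed

lemma trims_no_single:
  assumes "\<forall>n. f n < k"
  shows "\<not> single f (trims f s k) s n"
proof
  assume n: "single f (trims f s k) s n"
  with trims_colours[OF assms, of s k] have "f ` {trims f s k..<s} = {}"
    by (auto simp: card_eq_0_iff)
  with n show False by (auto simp: single_def)
qed

text \<open>
  At a later stage that sees both \<open>n\<close> and everything seen at stage \<open>s\<close>, the rank is still maximal, so
  the trimming ends at the same place; there, no position is single.
\<close>

lemma trims_solution:
  assumes "\<forall>n. f n < k" "\<And>t. rank k f t k \<le> rank k f s k" "trims f s k \<le> n"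
  shows "\<exists>m\<ge>trims f s k. m \<noteq> n \<and> f m = f n"
proof -
  define t where "t = max s (Suc n)"
  have t: "s \<le> t" "n < t" by (auto simp: t_def)
  with rank_mono[OF assms(1) t(1), where j = k] assms(2)[of t] have "trims f s k = trims f t k"
    by auto
  with trims_no_single[OF assms(1), of t n] t assms(3) show ?thesis
    by (auto simp: single_def)
qed

section \<open>Reducing ERT to finitely many uses of LPO\<close>

text \<open>
  The backward functional is taken to be whatever the program \<open>e\<close> computes, so only its values on
  actual solutions have to be examined.
\<close>

lemma weihrauch_leI:
  assumes "computable 1 (\<lambda>I ys. F I (ys ! 0))"
    and "\<And>I. I \<in> Domain P \<Longrightarrow> F I \<in> Domain Q"
    and "\<And>I S. I \<in> Domain P \<Longrightarrow> (F I, S) \<in> Q \<Longrightarrow> \<exists>T. eval I e [S] = Some T \<and> (I, T) \<in> P"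
  shows "P \<le>\<^sub>W Q"
proof -
  obtain f where "\<And>I ys. length ys = 1 \<Longrightarrow> eval I f ys = Some (F I (ys ! 0))"
    using assms(1) unfolding computable_def by blast
  then have "computable_functional (\<lambda>I. Some (F I))"
    unfolding computable_functional_def by (intro exI[where x = f]) simp
  moreover have "computable_functional_nat (\<lambda>(I, S). eval I e [S])"
    unfolding computable_functional_nat_def by auto
  ultimately show ?thesis
    unfolding weihrauch_le_def using assms(2,3)
    by (intro exI[where x = "\<lambda>I. Some (F I)"] exI[where x = "\<lambda>(I, S). eval I e [S]"]) auto
qed

text \<open>
  Unbounded search is the only source of partiality that is needed: it terminates whenever the
  second input is a correct list of answers.
\<close>

lemma computable_search:
  assumes "decidable 2 (\<lambda>I ys. P I (ys ! 0) (ys ! 1))" "computable 1 (\<lambda>I ys. G I (ys ! 0))"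
  obtains e where "\<And>I S. \<exists>s. P I s S \<Longrightarrow> \<exists>s. P I s S \<and> eval I e [S] = Some (G I s)"
proof -
  from decidable_not[OF assms(1)] obtain d where
    d: "\<And>I ys. length ys = 2 \<Longrightarrow> eval I d ys = Some (of_bool (\<not> P I (ys ! 0) (ys ! 1)))"
    unfolding decidable_def computable_def by blast
  obtain g where g: "\<And>I ys. length ys = 1 \<Longrightarrow> eval I g ys = Some (G I (ys ! 0))"
    using assms(2) unfolding computable_def by blast
  have "\<exists>s. P I s S \<and> eval I (Comp g [Mu d]) [S] = Some (G I s)" if ex: "\<exists>s. P I s S" for I S
  proof -
    define s where "s = (LEAST s. P I s S)"
    have s: "P I s S" "\<And>m. m < s \<Longrightarrow> \<not> P I m S"
      using ex unfolding s_def by (auto intro: LeastI_ex dest: not_less_Least)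
    have eval_d: "eval I d [m, S] = Some (of_bool (\<not> P I m S))" for m
      by (simp add: d)
    then have "(LEAST m. eval I d [m, S] = Some 0) = s"
      by (simp add: s_def)
    moreover have "eval I d [s, S] = Some 0 \<and> (\<forall>m<s. \<exists>y>0. eval I d [m, S] = Some y)"
      using s by (simp add: eval_d)
    ultimately have "eval I (Mu d) [S] = Some s"
      by (simp only: eval.simps) (metis (no_types, lifting))
    then have "eval I (Comp g [Mu d]) [S] = Some (G I s)"
      by (simp add: g del: eval.simps(7))
    with s(1) show ?thesis by blast
  qed
  then show thesis by (rule that)
qed

lemma ERT_iff:
  "(I, b) \<in> ERT \<longleftrightarrow>
    (\<forall>n. I (Suc n) < I 0) \<and> (\<forall>n\<ge>b. \<exists>m\<ge>b. m \<noteq> n \<and> I (Suc m) = I (Suc n))"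
proof -
  have "I = case_nat k f \<longleftrightarrow> k = I 0 \<and> f = (\<lambda>n. I (Suc n))" for k f
    by (auto simp: fun_eq_iff split: nat.split)
  then show ?thesis by (auto simp: ERT_def)
qed

lemma code_seq_0: "code_seq Is 0 = length Is"
  by (simp add: code_seq_def)

lemma code_seq_Suc: "i < length Is \<Longrightarrow> code_seq Is (Suc (prod_encode (i, m))) = (Is ! i) m"
  by (simp add: code_seq_def)

lemma code_seq_inject: "code_seq Is = code_seq Js \<longleftrightarrow> Is = Js"
proof
  assume eq: "code_seq Is = code_seq Js"
  then have len: "length Is = length Js"
    by (metis code_seq_0)
  show "Is = Js"
  proof (rule nth_equalityI[OF len])
    fix i assume "i < length Is"
    with eq len show "Is ! i = Js ! i"
      by (metis (no_types) code_seq_Suc ext)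
  qed
qed simp

lemma star_LPO_iff:
  "(code_seq Is, S) \<in> star LPO \<longleftrightarrow> S = list_encode (map (\<lambda>f. if \<exists>n. f n = 0 then 0 else 1) Is)"
proof -
  have "list_all2 (\<lambda>I S. (I, S) \<in> LPO) Js Ss \<longleftrightarrow> Ss = map (\<lambda>f. if \<exists>n. f n = 0 then 0 else 1) Js"
    for Js Ss
    by (auto simp: LPO_def list_all2_conv_all_nth list_eq_iff_nth_eq)
  then show ?thesis
    by (auto simp: star_def code_seq_inject)
qed

abbreviation colouring :: "baire \<Rightarrow> baire" where
  "colouring I \<equiv> \<lambda>n. I (Suc n)"

lemma decidable_single:
  assumes "computable n A" "computable n B" "computable n C"
  shows "decidable n (\<lambda>I xs. single (colouring I) (A I xs) (B I xs) (C I xs))"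
  by (rule decidable_comp3[where h = "\<lambda>I. single (colouring I)", OF _ assms],
      unfold single_def) (intro computable_intros; simp)

lemma decidable_fresh:
  assumes "computable n A" "computable n B"
  shows "decidable n (\<lambda>I xs. fresh (colouring I) (A I xs) (B I xs))"
  by (rule decidable_comp2[where h = "\<lambda>I. fresh (colouring I)", OF _ assms],
      unfold fresh_def) (intro computable_intros; simp)

lemma computable_trim:
  assumes "computable n A" "computable n B"
  shows "computable n (\<lambda>I xs. trim (colouring I) (A I xs) (B I xs))"
  by (rule computable_comp2[where h = "\<lambda>I. trim (colouring I)", OF _ assms], unfold trim_def)
    (intro computable_intros decidable_single; simp)

lemma computable_fresh_count:
  assumes "computable n A" "computable n B"
  shows "computable n (\<lambda>I xs. fresh_count (colouring I) (A I xs) (B I xs))"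
  by (rule computable_comp2[where h = "\<lambda>I. fresh_count (colouring I)", OF _ assms],
      unfold fresh_count_def)
    (intro computable_intros decidable_fresh; simp)

lemma computable_trims:
  assumes "computable n A" "computable n B"
  shows "computable n (\<lambda>I xs. trims (colouring I) (A I xs) (B I xs))"
proof (rule computable_comp2[where h = "\<lambda>I. trims (colouring I)", OF _ assms])
  have "rec_nat 0 (\<lambda>j a. trim f s a) j = trims f s j" for f s j
    by (induction j) simp_all
  moreover have "computable 2 (\<lambda>I ys. rec_nat 0 (\<lambda>j a. trim (colouring I) (ys ! 0) a) (ys ! 1))"
    by (intro computable_intros computable_trim; simp)
  ultimately show "computable 2 (\<lambda>I ys. trims (colouring I) (ys ! 0) (ys ! 1))" by simp
qed

lemma computable_rank:
  assumes "computable n A" "computable n B"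
  shows "computable n (\<lambda>I xs. rank (I 0) (colouring I) (A I xs) (B I xs))"
proof (rule computable_comp2[where h = "\<lambda>I. rank (I 0) (colouring I)", OF _ assms])
  have "rec_nat 0 (\<lambda>j r. Suc (2 * k) * r + fresh_count f (trims f s j) s) j = rank k f s j" for k f s j
    by (induction j) simp_all
  moreover have "computable 2 (\<lambda>I ys. rec_nat 0 (\<lambda>j r. Suc (2 * I 0) * r
      + fresh_count (colouring I) (trims (colouring I) (ys ! 0) j) (ys ! 0)) (ys ! 1))"
    by (intro computable_intros computable_fresh_count computable_trims; simp)
  ultimately show "computable 2 (\<lambda>I ys. rank (I 0) (colouring I) (ys ! 0) (ys ! 1))" by simp
qed

abbreviation rank_bound :: "baire \<Rightarrow> nat" where
  "rank_bound I \<equiv> Suc (2 * I 0) ^ I 0"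

abbreviation final_rank :: "baire \<Rightarrow> nat \<Rightarrow> nat" where
  "final_rank I s \<equiv> rank (I 0) (colouring I) s (I 0)"

definition rank_questions :: "baire \<Rightarrow> baire list" where
  "rank_questions I = map (\<lambda>i s. if i < final_rank I s then 0 else 1) [0..<rank_bound I]"

lemma code_rank_questions:
  "code_seq (rank_questions I) x =
    (if x = 0 then rank_bound I
     else if fst (prod_decode (x - 1)) < rank_bound I
     then if fst (prod_decode (x - 1)) < final_rank I (snd (prod_decode (x - 1))) then 0 else 1
     else 0)"
  by (cases x) (auto simp: code_seq_def rank_questions_def split: prod.split)

text \<open>
  The answers to the questions as they look at stage \<open>s\<close>. The true answers are recognised by comparing
  codes, so a code of a list never has to be decoded.
\<close>

definition rank_answers :: "baire \<Rightarrow> nat \<Rightarrow> nat" where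
  "rank_answers I s =
    list_encode (map (\<lambda>i. if i < final_rank I s then 0 else 1) [0..<rank_bound I])"

text \<open>
  The answers at stage \<open>s\<close> say that the numbers exceeded by some rank are those below the rank at
  stage \<open>s\<close>. As every rank is below the number of questions, this is true iff that rank is maximal.
\<close>

lemma rank_answers_eq_iff:
  assumes I: "\<forall>n. I (Suc n) < I 0"
  shows "(code_seq (rank_questions I), rank_answers I s) \<in> star LPO \<longleftrightarrow>
    (\<forall>t. final_rank I t \<le> final_rank I s)"
proof -
  have less: "final_rank I t < rank_bound I" for t
    using rank_less[of "colouring I" "I 0"] I by blast
  have "(code_seq (rank_questions I), rank_answers I s) \<in> star LPO \<longleftrightarrow>
      (\<forall>i<rank_bound I. i < final_rank I s \<longleftrightarrow> (\<exists>t. i < final_rank I t))"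
    unfolding star_LPO_iff rank_answers_def list_encode_eq
    by (auto simp: rank_questions_def split: if_splits)
  also have "\<dots> \<longleftrightarrow> (\<forall>t. final_rank I t \<le> final_rank I s)" (is "?same \<longleftrightarrow> ?maximal")
  proof
    assume ?same
    with less[of s] have "\<not> final_rank I s < final_rank I t" for t by blast
    then show ?maximal by (simp add: not_less)
  next
    assume ?maximal
    then show ?same by (blast intro: less_le_trans)
  qed
  finally show ?thesis .
qed

lemma final_rank_maximal:
  assumes I: "\<forall>n. I (Suc n) < I 0"
  shows "\<exists>s. \<forall>t. final_rank I t \<le> final_rank I s"
proof -
  have "\<forall>t. final_rank I t < rank_bound I"
    using rank_less[of "colouring I" "I 0"] I by blast
  then show ?thesis
    using ex_has_greatest_nat[of "\<lambda>_. True" 0 "final_rank I" "rank_bound I"] by blast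
qed

lemma ERT_le_star_LPO: "ERT \<le>\<^sub>W star LPO"
proof -
  have "decidable 2 (\<lambda>I ys. rank_answers I (ys ! 0) = ys ! 1)"
    unfolding rank_answers_def
    by (intro computable_intros computable_list_encode_map_upt computable_rank; simp)
  moreover have "computable 1 (\<lambda>I ys. trims (colouring I) (ys ! 0) (I 0))"
    by (intro computable_intros computable_trims; simp)
  ultimately obtain e where e: "\<And>I S. \<exists>s. rank_answers I s = S \<Longrightarrow>
      \<exists>s. rank_answers I s = S \<and> eval I e [S] = Some (trims (colouring I) s (I 0))"
    using computable_search[of "\<lambda>I s S. rank_answers I s = S"
        "\<lambda>I s. trims (colouring I) s (I 0)"] by blast
  show ?thesis
  proof (rule weihrauch_leI[where F = "\<lambda>I. code_seq (rank_questions I)" and e = e])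
    show "computable 1 (\<lambda>I ys. code_seq (rank_questions I) (ys ! 0))"
      unfolding code_rank_questions
      by (intro computable_intros computable_rank computable_fst_prod_decode
          computable_snd_prod_decode; simp)
  next
    fix I
    show "code_seq (rank_questions I) \<in> Domain (star LPO)"
      by (auto simp: Domain_iff star_LPO_iff)
  next
    fix I S
    assume "I \<in> Domain ERT" and S: "(code_seq (rank_questions I), S) \<in> star LPO"
    then have I: "\<forall>n. I (Suc n) < I 0"
      by (auto simp: ERT_iff)
    obtain s0 where "\<forall>t. final_rank I t \<le> final_rank I s0"
      using final_rank_maximal[OF I] by blast
    with rank_answers_eq_iff[OF I] have "(code_seq (rank_questions I), rank_answers I s0) \<in> star LPO"
      by blast
    with S have "rank_answers I s0 = S"
      by (simp add: star_LPO_iff)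
    with e obtain s where s: "rank_answers I s = S" "eval I e [S] = Some (trims (colouring I) s (I 0))"
      by blast
    with S rank_answers_eq_iff[OF I] have "\<And>t. final_rank I t \<le> final_rank I s"
      by blast
    from trims_solution[of "colouring I" "I 0", OF I this]
    have "(I, trims (colouring I) s (I 0)) \<in> ERT"
      using I unfolding ERT_iff by blast
    with s(2) show "\<exists>T. eval I e [S] = Some T \<and> (I, T) \<in> ERT"
      by blast
  qed
qed

section \<open>Reducing finitely many uses of LPO to ERT\<close>

text \<open>
  With \<open>t\<close> the code of \<open>(i, m)\<close> and \<open>I\<close> the code of a sequence of instances: \<open>m\<close> is the first zero of
  the \<open>i\<close>-th instance.
\<close>

definition first_zero :: "baire \<Rightarrow> nat \<Rightarrow> bool" where
  "first_zero I t \<longleftrightarrow> fst (prod_decode t) < I 0 \<and> I (Suc t) = 0 \<and>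
    (\<forall>m<snd (prod_decode t). I (Suc (prod_encode (fst (prod_decode t), m))) \<noteq> 0)"

text \<open>
  The colours below \<open>I 0\<close> belong to the instances, and \<open>I 0\<close> itself is the neutral colour.
\<close>

definition zero_colouring :: "baire \<Rightarrow> baire" where
  "zero_colouring I x = (if x = 0 then Suc (I 0)
    else if first_zero I (x - 1) then fst (prod_decode (x - 1)) else I 0)"

lemma first_zero_unique:
  assumes "first_zero I t" "first_zero I t'" "fst (prod_decode t) = fst (prod_decode t')"
  shows "t = t'"
proof -
  obtain i m where t: "prod_decode t = (i, m)" by fastforce
  with assms(3) obtain m' where t': "prod_decode t' = (i, m')" by (metis fst_conv prod.collapse)
  have tt: "t = prod_encode (i, m)" "t' = prod_encode (i, m')"
    by (simp_all flip: t t')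
  have "\<not> m < m'" "\<not> m' < m"
    using assms(1,2) t t' unfolding first_zero_def tt by auto
  then show ?thesis by (simp add: tt)
qed

lemma first_zero_exists:
  assumes "i < I 0" "I (Suc (prod_encode (i, m))) = 0"
  shows "\<exists>m. first_zero I (prod_encode (i, m))"
proof -
  from assms(2) obtain m' where "I (Suc (prod_encode (i, m'))) = 0"
    "\<forall>l<m'. I (Suc (prod_encode (i, l))) \<noteq> 0"
    using exists_least_iff[of "\<lambda>m. I (Suc (prod_encode (i, m))) = 0"] by blast
  with assms(1) have "first_zero I (prod_encode (i, m'))"
    by (simp add: first_zero_def)
  then show ?thesis ..
qed

text \<open>
  Each instance has at most one first zero, so from some position on all colours are neutral.
\<close>

lemma zero_colouring_in_Domain: "zero_colouring I \<in> Domain ERT"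
proof -
  have "inj_on (\<lambda>t. fst (prod_decode t)) (Collect (first_zero I))"
    by (auto intro!: inj_onI first_zero_unique)
  moreover have "(\<lambda>t. fst (prod_decode t)) ` Collect (first_zero I) \<subseteq> {..<I 0}"
    by (auto simp: first_zero_def)
  ultimately have "finite (Collect (first_zero I))"
    by (rule inj_on_finite) simp
  then obtain b where b: "\<And>t. first_zero I t \<Longrightarrow> t < b"
    using finite_nat_set_iff_bounded by auto
  then have "zero_colouring I (Suc t) = I 0" if "b \<le> t" for t
    using that by (force simp: zero_colouring_def)
  then have "\<exists>m\<ge>b. m \<noteq> n \<and> zero_colouring I (Suc m) = zero_colouring I (Suc n)" if "b \<le> n" for n
    using that by (intro exI[of _ "Suc n"]) simp
  moreover have "zero_colouring I (Suc n) < zero_colouring I 0" for n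
    by (auto simp: zero_colouring_def first_zero_def)
  ultimately have "(zero_colouring I, b) \<in> ERT"
    by (simp add: ERT_iff)
  then show ?thesis by blast
qed

text \<open>
  The colour of an instance with a zero occurs exactly once, so a solution \<open>b\<close> lies beyond its
  position, and the code of \<open>(i, m)\<close> is at least \<open>m\<close>.
\<close>

lemma zero_before_solution:
  assumes "(zero_colouring I, b) \<in> ERT" "i < I 0" "I (Suc (prod_encode (i, m))) = 0"
  shows "\<exists>m<b. I (Suc (prod_encode (i, m))) = 0"
proof -
  obtain m' where m': "first_zero I (prod_encode (i, m'))"
    using first_zero_exists[OF assms(2,3)] by blast
  have "prod_encode (i, m') < b"
  proof (rule ccontr)
    assume "\<not> prod_encode (i, m') < b"
    with assms(1) obtain t where t: "t \<noteq> prod_encode (i, m')"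
      "zero_colouring I (Suc t) = zero_colouring I (Suc (prod_encode (i, m')))"
      unfolding ERT_iff by (meson not_le)
    with m' assms(2) have "first_zero I t" "fst (prod_decode t) = i"
      by (auto simp: zero_colouring_def split: if_splits)
    with first_zero_unique[OF _ m'] t(1) show False by simp
  qed
  with le_prod_encode_2[of m' i] m' show ?thesis
    by (auto simp: first_zero_def intro: le_less_trans)
qed

lemma star_LPO_le_ERT: "star LPO \<le>\<^sub>W ERT"
proof -
  define answers where "answers I b =
    list_encode (map (\<lambda>i. if \<exists>m<b. I (Suc (prod_encode (i, m))) = 0 then 0 else 1) [0..<I 0])"
    for I :: baire and b
  have "computable 1 (\<lambda>I ys. answers I (ys ! 0))"
    unfolding answers_def
    by (intro computable_intros computable_list_encode_map_upt computable_prod_encode; simp)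
  then obtain e where "\<And>I ys. length ys = 1 \<Longrightarrow> eval I e ys = Some (answers I (ys ! 0))"
    unfolding computable_def by blast
  then have e: "eval I e [b] = Some (answers I b)" for I b
    by simp
  show ?thesis
  proof (rule weihrauch_leI[where F = zero_colouring and e = e])
    show "computable 1 (\<lambda>I ys. zero_colouring I (ys ! 0))"
      unfolding zero_colouring_def first_zero_def
      by (intro computable_intros computable_fst_prod_decode computable_snd_prod_decode
          computable_prod_encode; simp)
  next
    fix I
    show "zero_colouring I \<in> Domain ERT" by (rule zero_colouring_in_Domain)
  next
    fix I b
    assume "I \<in> Domain (star LPO)" and b: "(zero_colouring I, b) \<in> ERT"
    then obtain Is where I: "I = code_seq Is"
      by (auto simp: star_def)
    have "(\<exists>m<b. I (Suc (prod_encode (i, m))) = 0) \<longleftrightarrow> (\<exists>m. (Is ! i) m = 0)" if "i < length Is" for i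
      using zero_before_solution[OF b, of i] that by (auto simp: I code_seq_0 code_seq_Suc)
    then have "answers I b = list_encode (map (\<lambda>f. if \<exists>m. f m = 0 then 0 else 1) Is)"
      unfolding answers_def list_encode_eq
      by (intro nth_equalityI) (simp_all add: I code_seq_0)
    then show "\<exists>T. eval I e [b] = Some T \<and> (I, T) \<in> star LPO"
      by (simp add: e I star_LPO_iff)
  qed
qed

theorem theorem8: "ERT \<equiv>\<^sub>W star LPO"
  unfolding weihrauch_equiv_def using ERT_le_star_LPO star_LPO_le_ERT ..

end
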